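(* Let $\phi=\frac{1+\sqrt5}{2}$. Let $ABCD$ be a rectangle in the Euclidean plane with $BC=1$ and $AB=\phi$. Let $O$ be the point of segment $BC$ with $\frac{BO}{OC}=\phi$. Let $E$ be the point where the circle with center $O$ and radius of length $AC$ meets the extension of $BA$ beyond $A$. Then $\triangle EBC$ is a right triangle with side lengths $\left(1,\ \sqrt{2\phi},\ \phi\sqrt{\phi}\right)$, namely $BC=1$, $BE=\sqrt{2\phi}$ and $EC=\phi\sqrt{\phi}$. That is, $\triangle EBC$ is the triangle $T_2$.
   Context: For $n\ge 1$, $T_n$ denotes the right triangle with side lengths $\left(1,\ \sqrt{\frac{\phi F_{n+1}}{F_n}},\ \sqrt{\frac{\phi^{n+1}}{F_n}}\right)$, the last being the hypotenuse, where $F_n$ are the Fibonacci numbers ($F_0=0$, $F_1=1$, $F_{n+1}=F_n+F_{n-1}$). In particular, $T_2$ has side lengths $\left(1,\ \sqrt{2\phi},\ \phi\sqrt{\phi}\right)$. *)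

theory Defs
  imports "HOL-Analysis.Analysis" "HOL-Number_Theory.Fib"
begin

definition phi :: real where
  "phi = (1 + sqrt 5) / 2"

text \<open>The angle \<open>XYZ\<close>, with vertex \<open>Y\<close>, is right. Both legs are required to be nonzero, so that
  \<open>X\<close>, \<open>Y\<close>, \<open>Z\<close> are then the vertices of a non-degenerate right triangle.\<close>

definition right_angle :: "real ^ 2 \<Rightarrow> real ^ 2 \<Rightarrow> real ^ 2 \<Rightarrow> bool" where
  "right_angle X Y Z \<longleftrightarrow> X \<noteq> Y \<and> Z \<noteq> Y \<and> orthogonal (X - Y) (Z - Y)"

definition rectangle :: "real ^ 2 \<Rightarrow> real ^ 2 \<Rightarrow> real ^ 2 \<Rightarrow> real ^ 2 \<Rightarrow> bool" where
  "rectangle A B C D \<longleftrightarrow>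
     right_angle D A B \<and> right_angle A B C \<and> right_angle B C D \<and> right_angle C D A"

text \<open>The triangle with vertex set \<open>S\<close> is (congruent to) \<open>T\<^sub>n\<close>: a right triangle with legs
  \<open>1\<close> and \<open>sqrt (phi F\<^sub>n\<^sub>+\<^sub>1 / F\<^sub>n)\<close> and hypotenuse \<open>sqrt (phi\<^sup>n\<^sup>+\<^sup>1 / F\<^sub>n)\<close>. The vertices are given as
  a set because \<open>T\<^sub>n\<close> is determined up to congruence only, without labels.\<close>

definition is_T :: "nat \<Rightarrow> (real ^ 2) set \<Rightarrow> bool" where
  "is_T n S \<longleftrightarrow> 1 \<le> n \<and>
     (\<exists>P Q R. S = {P, Q, R} \<and> right_angle P Q R \<and>
        dist Q R = 1 \<and>
        dist Q P = sqrt (phi * real (fib (n + 1)) / real (fib n)) \<and>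
        dist P R = sqrt (phi ^ (n + 1) / real (fib n)))"

end

(* Put B at the origin with axes along C - B and A - B, and write O = B + t (C - B) and
   E = B + s (A - B). The ratio condition gives t = phi - 1, and phi^2 = phi + 1 turns
   t^2 + BE^2 = AC^2 = 1 + phi^2 into BE^2 = 2 phi. This exceeds phi^2 = AB^2, so there is exactly
   one such E beyond A, and EC^2 = 1 + 2 phi = phi^3. *)
theory Submission
  imports Defs
begin

lemma phi_squared: "phi\<^sup>2 = phi + 1"
  by (simp add: phi_def power2_eq_square field_simps)

lemma phi_gt_1: "1 < phi"
  by (simp add: phi_def)

lemma phi_lt_2: "phi < 2"
proof -
  have "sqrt 5 < sqrt (3\<^sup>2)"
    by (subst real_sqrt_less_iff) simp
  then show ?thesis
    by (simp add: phi_def)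
qed

lemma phi_cubed: "phi ^ 3 = 2 * phi + 1"
  using phi_squared by (simp add: power3_eq_cube power2_eq_square algebra_simps)

text \<open>Pythagoras for a point on each of two perpendicular axes through \<open>B\<close>. It
  later yields \<open>AC\<close> (with \<open>s = t = 1\<close>), the distance from the circle's
  center to \<open>E\<close>, and \<open>EC\<close>.\<close>

lemma dist_orthogonal_squared:
  fixes A B C :: "'a::real_inner"
  assumes "orthogonal (A - B) (C - B)"
  shows "(dist (B + s *\<^sub>R (A - B)) (B + t *\<^sub>R (C - B)))\<^sup>2 = s\<^sup>2 * (dist B A)\<^sup>2 + t\<^sup>2 * (dist B C)\<^sup>2"
proof -
  have "orthogonal (s *\<^sub>R (A - B)) (- (t *\<^sub>R (C - B)))"
    using assms by (simp add: orthogonal_def)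
  from norm_add_Pythagorean[OF this] show ?thesis
    by (simp add: dist_norm power_mult_distrib norm_minus_commute)
qed

text \<open>Makes "on the extension of \<open>BA\<close> beyond \<open>A\<close>" a condition on one
  real parameter. This \<open>s\<close> is the reciprocal of the parameter of \<open>A\<close> on
  the segment from \<open>B\<close> to \<open>E\<close>.\<close>

lemma mem_open_segment_iff_beyond:
  fixes A B E :: "'a::real_vector"
  assumes "A \<noteq> B"
  shows "A \<in> open_segment B E \<longleftrightarrow> (\<exists>s>1. E = B + s *\<^sub>R (A - B))"
proof
  assume "A \<in> open_segment B E"
  then obtain w where w: "0 < w" "w < 1" "A = (1 - w) *\<^sub>R B + w *\<^sub>R E"
    by (auto simp: in_segment)
  then have "A - B = w *\<^sub>R (E - B)"
    by (simp add: algebra_simps)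
  then have "E = B + (1 / w) *\<^sub>R (A - B)"
    using w by simp
  moreover have "1 / w > 1"
    using w by simp
  ultimately show "\<exists>s>1. E = B + s *\<^sub>R (A - B)"
    by blast
next
  assume "\<exists>s>1. E = B + s *\<^sub>R (A - B)"
  then obtain s where s: "s > 1" "E = B + s *\<^sub>R (A - B)"
    by blast
  have "(1 / s) *\<^sub>R E = (1 / s) *\<^sub>R B + (A - B)"
    using s by (simp add: scaleR_add_right)
  then have "A = (1 - 1 / s) *\<^sub>R B + (1 / s) *\<^sub>R E"
    by (simp add: scaleR_diff_left)
  moreover have "B \<noteq> E"
    using s assms by simp
  moreover have "0 < 1 / s" "1 / s < 1"
    using s by simp_all
  ultimately show "A \<in> open_segment B E"
    unfolding in_segment by blast
qed

text \<open>At parameter \<open>t\<close> the ratio is \<open>t / (1 - t)\<close>. Setting it equal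
  to \<open>phi\<close> gives \<open>t = phi / (phi + 1)\<close>, which is \<open>phi - 1\<close>
  because \<open>phi\<^sup>2 = phi + 1\<close>.\<close>

lemma golden_section_point:
  fixes B C X :: "'a::real_normed_vector"
  assumes "dist B C = 1"
  shows "X \<in> closed_segment B C \<and> dist B X / dist X C = phi \<longleftrightarrow> X = B + (phi - 1) *\<^sub>R (C - B)"
proof -
  have norm1: "norm (C - B) = 1"
    using assms by (simp add: dist_norm norm_minus_commute)
  have ratio: "dist B (B + t *\<^sub>R (C - B)) / dist (B + t *\<^sub>R (C - B)) C = t / (1 - t)"
    if "0 \<le> t" "t \<le> 1" for t
  proof -
    have "B + t *\<^sub>R (C - B) - C = (t - 1) *\<^sub>R (C - B)"
      by (simp add: algebra_simps)
    then show ?thesis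
      using that norm1 by (simp add: dist_norm)
  qed
  have solve: "t / (1 - t) = phi \<longleftrightarrow> t = phi - 1" for t
  proof
    assume eq: "t / (1 - t) = phi"
    \<comment> \<open>At \<open>t = 1\<close> the quotient is 0 by the convention on division by
      zero, so it cannot be \<open>phi\<close>.\<close>
    then have "t \<noteq> 1"
      using phi_gt_1 by auto
    then have "t * (phi + 1) = phi"
      using eq by (simp add: field_simps)
    moreover have "(phi - 1) * (phi + 1) = phi"
      using phi_squared by (simp add: power2_eq_square algebra_simps)
    ultimately show "t = phi - 1"
      using phi_gt_1 by (metis add_pos_pos less_trans mult_right_cancel less_irrefl zero_less_one)
  next
    assume "t = phi - 1"
    moreover have "phi - 1 = phi * (2 - phi)"
      using phi_squared by (simp add: power2_eq_square algebra_simps)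
    ultimately show "t / (1 - t) = phi"
      using phi_lt_2 by (simp add: divide_eq_eq)
  qed
  have seg: "X \<in> closed_segment B C \<longleftrightarrow> (\<exists>t. 0 \<le> t \<and> t \<le> 1 \<and> X = B + t *\<^sub>R (C - B))"
    by (auto simp: in_segment algebra_simps)
  show ?thesis
    unfolding seg using ratio solve phi_gt_1 phi_lt_2
    by (smt (verit))
qed

lemma circle_meets_ray:
  fixes A B C E :: "'a::real_inner"
  assumes orth: "orthogonal (A - B) (C - B)"
    and BC: "dist B C = 1" and BA: "dist B A = phi"
  shows "E \<in> sphere (B + (phi - 1) *\<^sub>R (C - B)) (dist A C) \<and> A \<in> open_segment B E \<longleftrightarrow>
    E = B + (sqrt (2 * phi) / phi) *\<^sub>R (A - B)"
proof -
  let ?O = "B + (phi - 1) *\<^sub>R (C - B)"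
  let ?s = "sqrt (2 * phi) / phi"
  have "A \<noteq> B"
    using BA phi_gt_1 by auto
  have AC: "(dist A C)\<^sup>2 = phi\<^sup>2 + 1"
    using dist_orthogonal_squared[OF orth, of 1 1] BC BA by simp
  have s_sq: "?s\<^sup>2 * phi\<^sup>2 = 2 * phi"
    using phi_gt_1 by (simp add: power_divide)
  \<comment> \<open>This places the candidate strictly beyond \<open>A\<close>, which existence
    needs: \<open>phi + 1 < 2 * phi\<close> as \<open>phi > 1\<close>.\<close>
  have "phi\<^sup>2 < 2 * phi"
    using phi_squared phi_gt_1 by simp
  then have "phi < sqrt (2 * phi)"
    by (rule real_less_rsqrt)
  then have s_gt_1: "?s > 1"
    using phi_gt_1 by simp
  have on_circle: "dist ?O (B + s *\<^sub>R (A - B)) = dist A C \<longleftrightarrow> s = ?s" if "s > 1" for s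
  proof -
    have "dist ?O (B + s *\<^sub>R (A - B)) = dist A C \<longleftrightarrow>
        (dist (B + s *\<^sub>R (A - B)) ?O)\<^sup>2 = (dist A C)\<^sup>2"
      by (simp add: dist_commute)
    also have "\<dots> \<longleftrightarrow> s\<^sup>2 * phi\<^sup>2 + (phi - 1)\<^sup>2 = phi\<^sup>2 + 1"
      using dist_orthogonal_squared[OF orth, of s "phi - 1"] AC BC BA by simp
    \<comment> \<open>Expanding \<open>(phi - 1)\<^sup>2\<close> cancels
      \<open>phi\<^sup>2 + 1\<close> on both sides and leaves \<open>2 * phi\<close>.\<close>
    also have "\<dots> \<longleftrightarrow> s\<^sup>2 * phi\<^sup>2 = ?s\<^sup>2 * phi\<^sup>2"
      unfolding s_sq by (auto simp: power2_diff)
    also have "\<dots> \<longleftrightarrow> s\<^sup>2 = ?s\<^sup>2"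
      using phi_gt_1 by (subst mult_right_cancel) auto
    \<comment> \<open>Being beyond \<open>A\<close> discards the negative root, the circle's other
      intersection with the line \<open>AB\<close>.\<close>
    also have "\<dots> \<longleftrightarrow> s = ?s"
      using that s_gt_1 by (subst power2_eq_iff_nonneg) auto
    finally show ?thesis .
  qed
  show ?thesis
    unfolding mem_open_segment_iff_beyond[OF \<open>A \<noteq> B\<close>] mem_sphere
    using on_circle s_gt_1 by blast
qed

theorem mainTheorem2:
  fixes A B C D :: "real ^ 2"
  assumes "rectangle A B C D"
    and "dist B C = 1"
    and "dist A B = phi"
  shows "(\<exists>!O'. O' \<in> closed_segment B C \<and> dist B O' / dist O' C = phi) \<and>
    (\<forall>O'. O' \<in> closed_segment B C \<and> dist B O' / dist O' C = phi \<longrightarrow>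
      (\<exists>!E. E \<in> sphere O' (dist A C) \<and> A \<in> open_segment B E) \<and>
      (\<forall>E. E \<in> sphere O' (dist A C) \<and> A \<in> open_segment B E \<longrightarrow>
        right_angle E B C \<and>
        dist B C = 1 \<and> dist B E = sqrt (2 * phi) \<and> dist E C = phi * sqrt phi \<and>
        is_T 2 {E, B, C}))"
proof -
  have orth: "orthogonal (A - B) (C - B)" and nz: "A \<noteq> B" "C \<noteq> B"
    using assms(1) by (auto simp: rectangle_def right_angle_def)
  have BA: "dist B A = phi"
    using assms(3) by (simp add: dist_commute)
  define s where "s = sqrt (2 * phi) / phi"
  define E where "E = B + s *\<^sub>R (A - B)"
  have "s > 0"
    using phi_gt_1 by (simp add: s_def)
  have right: "right_angle E B C"
    using orth nz \<open>s > 0\<close> by (simp add: right_angle_def E_def orthogonal_def)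
  have BE: "dist B E = sqrt (2 * phi)"
    using BA phi_gt_1 by (simp add: E_def s_def dist_norm norm_minus_commute)
  have "(dist E C)\<^sup>2 = s\<^sup>2 * phi\<^sup>2 + 1"
    using dist_orthogonal_squared[OF orth, of s 1] assms(2) BA by (simp add: E_def)
  also have "\<dots> = phi ^ 3"
    using phi_gt_1 by (simp add: s_def power_divide phi_cubed)
  finally have EC: "dist E C = sqrt (phi ^ 3)"
    by (simp add: real_sqrt_unique)
  have cube_root: "sqrt (phi ^ 3) = phi * sqrt phi"
    using phi_gt_1 by (simp add: power3_eq_cube real_sqrt_mult)
  \<comment> \<open>With these values the sides of \<open>T\<^sub>2\<close> read 1,
    \<open>sqrt (2 * phi)\<close> and \<open>sqrt (phi ^ 3)\<close>.\<close>
  have "fib 2 = 1" "fib 3 = 2"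
    by (simp_all add: numeral_eq_Suc)
  then have T: "is_T 2 {E, B, C}"
    unfolding is_T_def using right assms(2) BE EC
    by (intro conjI exI[of _ E] exI[of _ B] exI[of _ C]) (simp_all add: mult.commute)
  show ?thesis
    \<comment> \<open>Each incidence condition becomes an equation with an explicit point, so unique
      existence is immediate and the universal claims concern only that point.\<close>
    unfolding golden_section_point[OF assms(2)]
    using circle_meets_ray[OF orth assms(2) BA] right assms(2) BE EC cube_root T
    by (auto simp: E_def s_def)
qed

end
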